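(* Let $H(t)=e^{-t/2}$ for $t\ge 0$. Then for all integers $n\ge0$, $\underline{\mathrm{P}_n^H}$ is the $n$-th Legendre polynomial and $\mathrm{t}_n^H=\psi(\tfrac12)+\mathrm{h}_n$.
   Context: $\psi=\Gamma'/\Gamma$ is the digamma function, $\mathrm{h}_0=0$ and $\mathrm{h}_n=1+\frac12+\dots+\frac1n$. Legendre polynomials are normalized to have value $1$ at $1$: they are the orthogonal polynomials $\mathrm{L}_n\in\mathbb{R}[T]$ ($\deg \mathrm{L}_n=n$) for the scalar product $\frac12\int_{-1}^1 f(u)g(u)\,\mathrm{d}u$ with $\mathrm{L}_n(1)=1$. For $\mathrm{Re}\,s\ge0$ set $\psi_H(s)=\int_0^\infty\left(H(0)\frac{e^{-t}}{t}-H(t)\frac{e^{-st}}{1-e^{-t}}\right)\mathrm{d}t$ (here $\psi_H(s)=\psi(\frac12+s)$). On $\mathbb{R}^{n+1}$ let $\mathrm{q}_n^H(x)=\sum_{0\le i,j\le n}x_ix_j\psi_H(|i-j|)$ and $\phi_n(x)=\sum_{0\le k\le n}x_k$. The form $\mathrm{q}_n^H$ is negative definite on $\ker\phi_n$, so there is a unique $\mathrm{v}_n^H\in\mathbb{R}^{n+1}$ which is orthogonal to $\ker\phi_n$ with respect to $\mathrm{q}_n^H$ and satisfies $\phi_n(\mathrm{v}_n^H)=1$; set $\mathrm{t}_n^H=\mathrm{q}_n^H(\mathrm{v}_n^H)$. Writing $\mathrm{v}_n^H=(x_0,\dots,x_n)$, define the trigonometric polynomial $\mathrm{P}_n^H(x)=e^{-i\pi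 nx}\sum_{k=0}^nx_ke^{2i\pi kx}$. It is real valued, so that there is a unique $\underline{\mathrm{P}_n^H}\in\mathbb{R}[T]$ with $\mathrm{P}_n^H(x)=\underline{\mathrm{P}_n^H}(\cos\pi x)$. *)

theory Defs
  imports "HOL-Analysis.Analysis" "HOL-Computational_Algebra.Polynomial"
begin

text \<open>
  Generic in the type of the argument, like \<open>Digamma\<close>; it is meant for \<open>s\<close> with nonnegative real
  part. The quadratic form below uses it at type \<open>real\<close>. Only the values of \<open>H\<close> on \<open>[0, \<infinity>)\<close> matter.
\<close>
definition psi_H ::
    "(real \<Rightarrow> real) \<Rightarrow> 'a \<Rightarrow> 'a :: {real_normed_field, banach, second_countable_topology}" where
  "psi_H H s = (LBINT t:{0<..}.
      of_real (H 0 * (exp (- t) / t)) - of_real (H t) * (exp (- s * of_real t) / of_real (1 - exp (- t))))"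

text \<open>
  A vector \<open>(x\<^sub>0, \<dots>, x\<^sub>n)\<close> of \<open>\<real>\<^bsup>n+1\<^esup>\<close> is a function on the natural numbers vanishing beyond \<open>n\<close>.
\<close>
definition coord_space :: "nat \<Rightarrow> (nat \<Rightarrow> real) set" where
  "coord_space n = {x. \<forall>k>n. x k = 0}"

definition phi_sum :: "nat \<Rightarrow> (nat \<Rightarrow> real) \<Rightarrow> real" where
  "phi_sum n x = (\<Sum>k\<le>n. x k)"

definition q_H :: "(real \<Rightarrow> real) \<Rightarrow> nat \<Rightarrow> (nat \<Rightarrow> real) \<Rightarrow> real" where
  "q_H H n x = (\<Sum>i\<le>n. \<Sum>j\<le>n. x i * x j * psi_H H \<bar>real i - real j\<bar>)"

definition b_H :: "(real \<Rightarrow> real) \<Rightarrow> nat \<Rightarrow> (nat \<Rightarrow> real) \<Rightarrow> (nat \<Rightarrow> real) \<Rightarrow> real" where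
  "b_H H n x y = (\<Sum>i\<le>n. \<Sum>j\<le>n. x i * y j * psi_H H \<bar>real i - real j\<bar>)"

text \<open>Orthogonality with respect to \<open>q_H\<close> refers to \<open>b_H\<close>, its polar form.\<close>

lemma b_H_polar: "b_H H n x y = (q_H H n (\<lambda>k. x k + y k) - q_H H n x - q_H H n y) / 2"
proof -
  have sym: "(\<Sum>i\<le>n. \<Sum>j\<le>n. y i * x j * psi_H H \<bar>real i - real j\<bar>)
      = (\<Sum>i\<le>n. \<Sum>j\<le>n. x i * y j * psi_H H \<bar>real i - real j\<bar>)"
    by (subst sum.swap) (simp add: abs_minus_commute mult.commute)
  show ?thesis
    using sym by (simp add: b_H_def q_H_def algebra_simps sum.distrib)
qed

definition v_H :: "(real \<Rightarrow> real) \<Rightarrow> nat \<Rightarrow> nat \<Rightarrow> real" where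
  "v_H H n = (THE v. v \<in> coord_space n \<and>
      (\<forall>x\<in>coord_space n. phi_sum n x = 0 \<longrightarrow> b_H H n v x = 0) \<and> phi_sum n v = 1)"

definition t_H :: "(real \<Rightarrow> real) \<Rightarrow> nat \<Rightarrow> real" where
  "t_H H n = q_H H n (v_H H n)"

definition P_H :: "(real \<Rightarrow> real) \<Rightarrow> nat \<Rightarrow> real \<Rightarrow> complex" where
  "P_H H n x = exp (- \<i> * of_real (pi * real n * x)) *
      (\<Sum>k\<le>n. of_real (v_H H n k) * exp (2 * \<i> * of_real (pi * real k * x)))"

definition P_H_poly :: "(real \<Rightarrow> real) \<Rightarrow> nat \<Rightarrow> real poly" where
  "P_H_poly H n = (THE p. \<forall>x::real. P_H H n x = of_real (poly p (cos (pi * x))))"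

definition legendre_poly :: "nat \<Rightarrow> real poly" where
  "legendre_poly = (THE L. (\<forall>n. degree (L n) = n) \<and>
      (\<forall>m n. m \<noteq> n \<longrightarrow> 1 / 2 * (LBINT u:{-1..1}. poly (L m) u * poly (L n) u) = 0) \<and>
      (\<forall>n. poly (L n) 1 = 1))"

end

theory Submission
  imports Defs "HOL-Real_Asymp.Real_Asymp"
begin

text \<open>
  By Gauss's integral \<open>\<psi>\<^sub>H(s) = Digamma (s + 1/2)\<close>, so consecutive rows of the matrix
  \<open>\<psi>\<^sub>H(|i - j|)\<close> differ by the Cauchy kernel \<open>1 / (i + 1/2 - j)\<close>, and a vector \<open>v\<close> is orthogonal
  to \<open>ker \<phi>\<^sub>n\<close> iff the rational function \<open>\<Sum>j. v\<^sub>j / (x - j)\<close> vanishes at \<open>1/2, \<dots>, n - 1/2\<close>.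
  This forces it to be \<open>(\<Prod>i<n. x - i - 1/2) / (\<Prod>k\<le>n. x - k)\<close> up to a factor, so that
  \<open>v\<^sub>j = p\<^sub>j p\<^sub>n\<^sub>-\<^sub>j\<close> with \<open>p\<^sub>k = (2k choose k) / 4\<^sup>k\<close>. These are the Fourier coefficients of the Legendre
  polynomial at \<open>cos \<theta>\<close>, as \<open>(1 - 2 X cos \<theta> + X\<^sup>2)\<^bsup>-1/2\<^esup>\<close> factors into two binomial series. The first
  row, hence every row, takes the value \<open>Digamma (1/2) + h\<^sub>n\<close> at \<open>v\<close>.
\<close>

subsection \<open>Residue weights and the Cauchy kernel\<close>

text \<open>The coefficient of X^k in (1 - X)^(-1/2). The Pochhammer form lets the parameter 1/2
  vary later.\<close>

definition half_binom :: "nat \<Rightarrow> real" where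
  "half_binom k = pochhammer (1 / 2) k / fact k"

lemma half_binom_0 [simp]: "half_binom 0 = 1"
  by (simp add: half_binom_def)

lemma half_binom_Suc: "half_binom (Suc k) = half_binom k * (1 / 2 + real k) / (1 + real k)"
  by (simp add: half_binom_def pochhammer_Suc algebra_simps)

text \<open>The value 0 beyond \<open>n\<close> places the vector in
  \<open>coord_space n\<close>.\<close>

definition legendre_weight :: "nat \<Rightarrow> nat \<Rightarrow> real" where
  "legendre_weight n k = (if k \<le> n then half_binom k * half_binom (n - k) else 0)"

lemma legendre_weight_beyond: "k > n \<Longrightarrow> legendre_weight n k = 0"
  by (simp add: legendre_weight_def)

text \<open>The numerator of \<open>\<Sum>j\<le>n. d\<^sub>j / (x - j)\<close> over the common denominator.\<close>
definition node_poly :: "nat \<Rightarrow> (nat \<Rightarrow> real) \<Rightarrow> real poly" where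
  "node_poly n d = (\<Sum>j\<le>n. smult (d j) (\<Prod>k\<in>{..n}-{j}. [:- real k, 1:]))"

lemma node_basis_monic:
  assumes "j \<le> n"
  shows "degree (\<Prod>k\<in>{..n}-{j}. [:- real k, 1:]) = n"
    and "coeff (\<Prod>k\<in>{..n}-{j}. [:- real k, 1:]) n = 1"
proof -
  show *: "degree (\<Prod>k\<in>{..n}-{j}. [:- real k, 1:]) = n"
    using assms by (subst degree_prod_eq_sum_degree) auto
  show "coeff (\<Prod>k\<in>{..n}-{j}. [:- real k, 1:]) n = 1"
    using lead_coeff_prod[of "\<lambda>k. [:- real k, 1:]" "{..n}-{j}"] unfolding * by simp
qed

lemma degree_node_poly: "degree (node_poly n d) \<le> n"
  unfolding node_poly_def by (intro degree_sum_le) (auto simp: node_basis_monic)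

lemma coeff_node_poly: "coeff (node_poly n d) n = (\<Sum>j\<le>n. d j)"
  unfolding node_poly_def by (simp add: coeff_sum node_basis_monic)

lemma poly_node_poly_node:
  assumes "j \<le> n"
  shows "poly (node_poly n d) (real j) = d j * (\<Prod>k\<in>{..n}-{j}. real j - real k)"
proof -
  have "poly (node_poly n d) (real j) =
      (\<Sum>i\<le>n. d i * (\<Prod>k\<in>{..n}-{i}. real j - real k))"
    by (simp add: node_poly_def poly_sum poly_prod)
  also have "\<dots> = (\<Sum>i\<le>n. if i = j then d j * (\<Prod>k\<in>{..n}-{j}. real j - real k) else 0)"
    using assms by (intro sum.cong) auto
  finally show ?thesis using assms by simp
qed

lemma poly_node_poly_off_node:
  assumes "\<And>j. j \<le> n \<Longrightarrow> x \<noteq> real j"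
  shows "poly (node_poly n d) x = (\<Prod>k\<le>n. x - real k) * (\<Sum>j\<le>n. d j / (x - real j))"
proof -
  have "(\<Prod>k\<in>{..n}-{j}. x - real k) = (\<Prod>k\<le>n. x - real k) / (x - real j)" if "j \<le> n" for j
    using assms[OF that] that by (subst prod.remove[of "{..n}" j]) auto
  then show ?thesis
    by (auto simp: node_poly_def poly_sum poly_prod sum_distrib_left intro!: sum.cong)
qed

lemma half_integer_neq: "real i + 1 / 2 \<noteq> real j"
proof
  assume "real i + 1 / 2 = real j"
  then have "real (2 * i + 1) = real (2 * j)" by simp
  then have "2 * i + 1 = 2 * j" using of_nat_eq_iff by blast
  then show False by presburger
qed

lemma half_integer_inj: "inj_on (\<lambda>i. real i + 1 / 2) {..<n}"
  by (auto intro: inj_onI)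

text \<open>Half-integers avoid all nodes, so the common denominator is nonzero there.\<close>

lemma poly_node_poly_half:
  "poly (node_poly n d) (real i + 1 / 2) = 0 \<longleftrightarrow> (\<Sum>j\<le>n. d j / (real i + 1 / 2 - real j)) = 0"
  using half_integer_neq[of i] by (subst poly_node_poly_off_node) (auto simp: algebra_simps)

text \<open>The first hypothesis kills the coefficient of x^n, so the numerator has degree below n
  or is 0, yet it has n distinct half-integer zeros. It is therefore 0, and its value at the node
  \<open>j\<close> is \<open>d j\<close> times a nonzero product.\<close>

lemma cauchy_kernel_trivial:
  assumes "(\<Sum>j\<le>n. d j) = 0"
    and "\<And>i. i < n \<Longrightarrow> (\<Sum>j\<le>n. d j / (real i + 1 / 2 - real j)) = 0"
    and "j \<le> n"
  shows "d j = 0"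
proof -
  have "node_poly n d = 0"
  proof (rule poly_eqI_degree_lead_coeff)
    show "coeff (node_poly n d) n = coeff 0 n"
      using assms(1) by (simp add: coeff_node_poly)
    show "n \<le> card ((\<lambda>i. real i + 1 / 2) ` {..<n})"
      by (simp add: card_image half_integer_inj)
    show "poly (node_poly n d) z = poly 0 z" if "z \<in> (\<lambda>i. real i + 1 / 2) ` {..<n}" for z
      using that assms(2) poly_node_poly_half by auto
  qed (simp_all add: degree_node_poly)
  then have "d j * (\<Prod>k\<in>{..n}-{j}. real j - real k) = 0"
    using poly_node_poly_node[OF assms(3), of d] by simp
  then show ?thesis by auto
qed

text \<open>The factors with i < j, read backwards, form one Pochhammer symbol; those with i \<ge> j
  form another up to sign.\<close>

lemma pochhammer_half_prod:
  assumes "j \<le> n"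
  shows "(\<Prod>i<n. real j - (real i + 1 / 2)) =
    (-1) ^ (n - j) * (pochhammer (1 / 2) j * pochhammer (1 / 2) (n - j))"
proof -
  have "{..<n} = {..<j} \<union> {j..<n}" using assms by auto
  then have "(\<Prod>i<n. real j - (real i + 1 / 2)) =
      (\<Prod>i<j. real j - (real i + 1 / 2)) * (\<Prod>i=j..<n. real j - (real i + 1 / 2))"
    by (simp add: prod.union_disjoint ivl_disj_int)
  also have "(\<Prod>i<j. real j - (real i + 1 / 2)) = pochhammer (1 / 2) j"
    unfolding pochhammer_prod atLeast0LessThan
    by (rule prod.reindex_bij_witness[of _ "\<lambda>i. j - 1 - i" "\<lambda>i. j - 1 - i"]) (auto simp: of_nat_diff)
  also have "(\<Prod>i=j..<n. real j - (real i + 1 / 2)) = (\<Prod>i<n-j. - (1 / 2 + real i))"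
    by (rule prod.reindex_bij_witness[of _ "\<lambda>i. i + j" "\<lambda>i. i - j"]) (auto simp: of_nat_diff)
  also have "\<dots> = (-1) ^ (n - j) * pochhammer (1 / 2) (n - j)"
    unfolding prod_uminus pochhammer_prod atLeast0LessThan by simp
  finally show ?thesis by simp
qed

text \<open>Splitting at \<open>j\<close> gives two factorials with the same sign as in
  \<open>pochhammer_half_prod\<close>, so the signs cancel in the residue.\<close>

lemma node_difference_prod:
  assumes "j \<le> n"
  shows "(\<Prod>k\<in>{..n}-{j}. real j - real k) = (-1) ^ (n - j) * (fact j * fact (n - j))"
proof -
  have "{..n}-{j} = {..<j} \<union> {Suc j..n}" using assms by auto
  moreover have "{..<j} \<inter> {Suc j..n} = {}" by auto
  ultimately have "(\<Prod>k\<in>{..n}-{j}. real j - real k) =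
      (\<Prod>k<j. real j - real k) * (\<Prod>k=Suc j..n. real j - real k)"
    by (simp add: prod.union_disjoint)
  also have "(\<Prod>k<j. real j - real k) = fact j"
    unfolding fact_prod of_nat_prod
    by (rule prod.reindex_bij_witness[of _ "\<lambda>i. j - i" "\<lambda>i. j - i"]) (auto simp: of_nat_diff)
  also have "(\<Prod>k=Suc j..n. real j - real k) = (\<Prod>i=1..n-j. - real i)"
    by (rule prod.reindex_bij_witness[of _ "\<lambda>i. i + j" "\<lambda>i. i - j"]) (auto simp: of_nat_diff)
  also have "\<dots> = (-1) ^ (n - j) * fact (n - j)"
    unfolding prod_uminus fact_prod of_nat_prod by simp
  finally show ?thesis by simp
qed

text \<open>The weights are the residues of (\<Prod>i<n. x - i - 1/2) / (\<Prod>k\<le>n. x - k):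
  numerator and \<open>node_poly\<close> agree at the n + 1 nodes and have degree at most n. The
  numerator visibly vanishes at i + 1/2.\<close>

lemma legendre_weight_cauchy:
  assumes "i < n"
  shows "(\<Sum>j\<le>n. legendre_weight n j / (real i + 1 / 2 - real j)) = 0"
proof -
  let ?N = "\<Prod>i<n. [:- (real i + 1 / 2), 1:]"
  have deg: "degree ?N = n"
    by (subst degree_prod_eq_sum_degree) auto
  have "node_poly n (legendre_weight n) = ?N"
  proof (rule poly_eqI_degree[where A = "real ` {..n}"])
    fix x assume "x \<in> real ` {..n}"
    then obtain j where j: "j \<le> n" "x = real j" by auto
    have "poly ?N (real j) = (\<Prod>i<n. real j - (real i + 1 / 2))"
      by (simp add: poly_prod algebra_simps)
    then show "poly (node_poly n (legendre_weight n)) x = poly ?N x"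
      using j by (simp add: poly_node_poly_node pochhammer_half_prod node_difference_prod
          legendre_weight_def half_binom_def)
  next
    show "degree ?N < card (real ` {..n})" unfolding deg by (simp add: card_image)
  qed (simp add: degree_node_poly card_image le_imp_less_Suc)
  then have "poly (node_poly n (legendre_weight n)) (real i + 1 / 2) = 0"
    using assms by (auto simp: poly_prod)
  then show ?thesis by (simp add: poly_node_poly_half)
qed

section \<open>Vandermonde convolution and harmonic numbers\<close>

lemma pochhammer_has_derivative:
  fixes s :: real
  assumes "s > 0"
  shows "((\<lambda>s. pochhammer s n) has_field_derivative
    pochhammer s n * (\<Sum>l<n. 1 / (s + real l))) (at s)"
proof (induction n)
  case (Suc n)
  have "s + real n \<noteq> 0" using assms by (simp add: add_pos_nonneg less_imp_neq)
  then show ?case unfolding pochhammer_Suc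
    by (auto intro!: derivative_eq_intros Suc simp: field_simps)
qed auto

text \<open>Vandermonde's convolution with one parameter fixed at 1/2; the other stays free for
  differentiation.\<close>

lemma pochhammer_half_vandermonde:
  "(\<Sum>j\<le>n. pochhammer s j / fact j * half_binom (n - j)) = pochhammer (s + 1 / 2) n / fact n"
  for s :: real
proof -
  have "pochhammer s j / fact j * half_binom (n - j) =
      real (n choose j) * pochhammer s j * pochhammer (1 / 2) (n - j) / fact n" if "j \<le> n" for j
    using that by (simp add: half_binom_def binomial_fact field_simps)
  then show ?thesis
    by (simp add: pochhammer_binomial_sum[of s "1 / 2" n] sum_divide_distrib)
qed

lemma sum_legendre_weight: "(\<Sum>j\<le>n. legendre_weight n j) = 1"
proof -
  have "(\<Sum>j\<le>n. legendre_weight n j) = (\<Sum>j\<le>n. pochhammer (1 / 2) j / fact j * half_binom (n - j))"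
    by (intro sum.cong) (auto simp: legendre_weight_def half_binom_def)
  then show ?thesis
    unfolding pochhammer_half_vandermonde by (simp add: pochhammer_fact[symmetric])
qed

text \<open>Differentiate the Vandermonde convolution in its parameter at \<open>1/2\<close>.\<close>
lemma sum_legendre_weight_odd_harm:
  "(\<Sum>j\<le>n. legendre_weight n j * (\<Sum>l<j. 1 / (1 / 2 + real l))) = harm n"
proof -
  have "((\<lambda>s. \<Sum>j\<le>n. pochhammer s j / fact j * half_binom (n - j)) has_field_derivative
      (\<Sum>j\<le>n. pochhammer (1 / 2) j * (\<Sum>l<j. 1 / (1 / 2 + real l)) / fact j * half_binom (n - j)))
      (at (1 / 2))"
    by (intro DERIV_sum DERIV_cmult_right DERIV_cdivide pochhammer_has_derivative) simp
  moreover have "((\<lambda>s. pochhammer (s + 1 / 2) n / fact n) has_field_derivative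
      pochhammer 1 n * (\<Sum>l<n. 1 / (1 + real l)) / fact n) (at (1 / 2))"
  proof -
    \<comment> \<open>The point 1 is written as 1/2 + 1/2 so that the shift rule for derivatives
      applies.\<close>
    have "((\<lambda>s. pochhammer s n) has_field_derivative
        pochhammer 1 n * (\<Sum>l<n. 1 / (1 + real l))) (at (1 / 2 + 1 / 2 :: real))"
      using pochhammer_has_derivative[of 1 n] by simp
    then show ?thesis by (intro DERIV_cdivide) (simp only: DERIV_shift)
  qed
  ultimately have "(\<Sum>j\<le>n. pochhammer (1 / 2) j * (\<Sum>l<j. 1 / (1 / 2 + real l)) / fact j * half_binom (n - j))
      = pochhammer 1 n * (\<Sum>l<n. 1 / (1 + real l)) / fact n"
    unfolding pochhammer_half_vandermonde by (rule DERIV_unique)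
  also have "\<dots> = (\<Sum>l<n. 1 / (1 + real l))"
    by (simp add: pochhammer_fact[symmetric])
  also have "\<dots> = harm n"
    unfolding harm_def
    by (rule sum.reindex_bij_witness[of _ "\<lambda>i. i - 1" Suc]) (auto simp: inverse_eq_divide)
  finally show ?thesis
    by (subst (asm) sum.cong[OF refl, of _ _ "\<lambda>j. legendre_weight n j * (\<Sum>l<j. 1 / (1 / 2 + real l))"])
       (auto simp: legendre_weight_def half_binom_def)
qed

subsection \<open>Legendre polynomials\<close>

text \<open>Bonnet's three-term recurrence for the Legendre polynomials.\<close>

fun legendre_rec :: "nat \<Rightarrow> real poly" where
  "legendre_rec 0 = 1"
| "legendre_rec (Suc 0) = [:0, 1:]"
| "legendre_rec (Suc (Suc n)) = smult (1 / (real n + 2))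
     (smult (2 * real n + 3) ([:0, 1:] * legendre_rec (Suc n)) - smult (real n + 1) (legendre_rec n))"

text \<open>Only the term multiplied by the variable reaches the top degree, so positivity of the
  top coefficient propagates and makes the degree exact.\<close>

lemma degree_legendre_rec_aux: "degree (legendre_rec n) \<le> n \<and> coeff (legendre_rec n) n > 0"
proof (induction n rule: legendre_rec.induct)
  case (3 n)
  let ?p = "smult (2 * real n + 3) ([:0, 1:] * legendre_rec (Suc n))"
    and ?q = "smult (real n + 1) (legendre_rec n)"
  have "degree ?p \<le> Suc (Suc n)"
    using 3(1) degree_pCons_le[of 0 "legendre_rec (Suc n)"]
      degree_smult_le[of "2 * real n + 3" "[:0, 1:] * legendre_rec (Suc n)"] by simp
  moreover have q: "degree ?q \<le> n"
    using 3(2) degree_smult_le[of "real n + 1" "legendre_rec n"] by linarith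
  ultimately have "degree (?p - ?q) \<le> Suc (Suc n)"
    by (intro degree_diff_le) auto
  moreover have "coeff ?p (Suc (Suc n)) > 0"
    using 3(1) by simp
  moreover have "coeff ?q (Suc (Suc n)) = 0"
    using q by (intro coeff_eq_0) simp
  ultimately show ?case
    using degree_smult_le[of "1 / (real n + 2)" "?p - ?q"]
    unfolding legendre_rec.simps(3) coeff_smult[of "1 / (real n + 2)"] coeff_diff by force
qed auto

lemma degree_legendre_rec: "degree (legendre_rec n) = n"
  using degree_legendre_rec_aux[of n] le_degree[of "legendre_rec n" n] by (intro antisym) auto

lemma poly_legendre_rec_1: "poly (legendre_rec n) 1 = 1"
  by (induction n rule: legendre_rec.induct) (auto simp: field_simps)

lemma poly_legendre_rec_Suc_Suc:
  "(real n + 2) * poly (legendre_rec (Suc (Suc n))) u =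
    (2 * real n + 3) * u * poly (legendre_rec (Suc n)) u - (real n + 1) * poly (legendre_rec n) u"
  by (simp add: field_simps)

lemma poly_pderiv_legendre_rec_Suc_Suc:
  "(real n + 2) * poly (pderiv (legendre_rec (Suc (Suc n)))) u =
    (2 * real n + 3) * (poly (legendre_rec (Suc n)) u + u * poly (pderiv (legendre_rec (Suc n))) u)
    - (real n + 1) * poly (pderiv (legendre_rec n)) u"
  by (simp add: pderiv_smult pderiv_diff pderiv_pCons field_simps del: of_nat_Suc)

declare legendre_rec.simps(3) [simp del]

text \<open>The two identities are proved together: the next first one comes from the current second
  one and the differentiated recurrence, the next second one from both.\<close>

lemma pderiv_legendre_rec_ladder:
  "poly (pderiv (legendre_rec (Suc n))) u =
      u * poly (pderiv (legendre_rec n)) u + (real n + 1) * poly (legendre_rec n) u \<and>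
   u * poly (pderiv (legendre_rec (Suc n))) u =
      poly (pderiv (legendre_rec n)) u + (real n + 1) * poly (legendre_rec (Suc n)) u"
proof (induction n)
  case 0
  then show ?case by (simp add: pderiv_pCons)
next
  case (Suc n)
  let ?a = "poly (legendre_rec n) u" and ?b = "poly (legendre_rec (Suc n)) u"
    and ?c = "poly (legendre_rec (Suc (Suc n))) u"
  let ?a' = "poly (pderiv (legendre_rec n)) u" and ?b' = "poly (pderiv (legendre_rec (Suc n))) u"
    and ?c' = "poly (pderiv (legendre_rec (Suc (Suc n)))) u"
  note rec = poly_legendre_rec_Suc_Suc[of n u] poly_pderiv_legendre_rec_Suc_Suc[of n u]
  have 1: "?b' = u * ?a' + (real n + 1) * ?a" and 2: "u * ?b' = ?a' + (real n + 1) * ?b"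
    using Suc by auto
  have "(real n + 2) * ?c' = (real n + 2) * (u * ?b' + (real n + 2) * ?b)"
    using 2 rec by algebra
  then have 3: "?c' = u * ?b' + (real n + 2) * ?b"
    by simp
  have 4: "u * ?c' = ?b' + (real n + 2) * ?c"
    using 1 2 3 rec by algebra
  show ?case using 3 4 by (simp add: add_ac)
qed

text \<open>Legendre's equation in self-adjoint form, ready for integration over [-1, 1].\<close>

lemma legendre_rec_ode:
  "((\<lambda>u. (1 - u\<^sup>2) * poly (pderiv (legendre_rec n)) u) has_field_derivative
    - real n * (real n + 1) * poly (legendre_rec n) u) (at u)"
proof (cases n)
  case 0
  then show ?thesis by simp
next
  case (Suc m)
  let ?a = "\<lambda>u. poly (legendre_rec m) u" and ?b = "\<lambda>u. poly (legendre_rec n) u"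
  \<comment> \<open>Eliminating the derivative of the lower polynomial from the ladder leaves an
    expression whose derivative the ladder simplifies again.\<close>
  have eq: "(1 - u\<^sup>2) * poly (pderiv (legendre_rec n)) u = real n * (?a u - u * ?b u)" for u
    using pderiv_legendre_rec_ladder[of m u] unfolding Suc of_nat_Suc by algebra
  have "((\<lambda>u. real n * (?a u - u * ?b u)) has_field_derivative
      real n * (poly (pderiv (legendre_rec m)) u - (?b u + u * poly (pderiv (legendre_rec n)) u))) (at u)"
    by (auto intro!: derivative_eq_intros poly_DERIV)
  also have "real n * (poly (pderiv (legendre_rec m)) u - (?b u + u * poly (pderiv (legendre_rec n)) u))
      = - real n * (real n + 1) * ?b u"
    using pderiv_legendre_rec_ladder[of m u] unfolding Suc of_nat_Suc by algebra
  finally show ?thesis unfolding eq .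
qed

lemma set_integrable_poly: "set_integrable lborel {a..b} (poly p)" for p :: "real poly"
  by (intro borel_integrable_atLeastAtMost' continuous_intros)

text \<open>Lagrange's identity: \<open>?F\<close> is a primitive of the product times the
  eigenvalue difference \<open>?c\<close>, and its factor 1 - u^2 vanishes at both
  endpoints.\<close>

lemma legendre_rec_orthogonal:
  assumes "m \<noteq> n"
  shows "(LBINT u:{-1..1}. poly (legendre_rec m) u * poly (legendre_rec n) u) = 0"
proof -
  let ?L = "\<lambda>k u. poly (legendre_rec k) u"
  let ?F = "\<lambda>u. (1 - u\<^sup>2) * poly (pderiv (legendre_rec m)) u * ?L n u -
      (1 - u\<^sup>2) * poly (pderiv (legendre_rec n)) u * ?L m u"
  let ?c = "real n * (real n + 1) - real m * (real m + 1)"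
  have "(?F has_field_derivative ?c * (?L m u * ?L n u)) (at u)" for u
    by (rule derivative_eq_intros legendre_rec_ode poly_DERIV refl)+ (simp add: algebra_simps)
  then have "(LBINT u:{-1..1}. ?c * (?L m u * ?L n u)) = ?F 1 - ?F (-1)"
    unfolding set_lebesgue_integral_def
    by (subst integral_FTC_Icc_real[where F = ?F, symmetric]) (auto intro!: continuous_intros simp: mult_ac)
  then have "?c * (LBINT u:{-1..1}. ?L m u * ?L n u) = 0"
    by simp
  moreover have "?c = (real n - real m) * (real n + real m + 1)"
    by algebra
  ultimately show ?thesis using assms by auto
qed

section \<open>Existence and uniqueness of the system described by
  \<open>legendre_poly\<close>\<close>

definition legendre_system :: "(nat \<Rightarrow> real poly) \<Rightarrow> bool" where
  "legendre_system L \<longleftrightarrow> (\<forall>n. degree (L n) = n) \<and>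
      (\<forall>m n. m \<noteq> n \<longrightarrow> 1 / 2 * (LBINT u:{-1..1}. poly (L m) u * poly (L n) u) = 0) \<and>
      (\<forall>n. poly (L n) 1 = 1)"

lemma legendre_system_legendre_rec: "legendre_system legendre_rec"
  by (simp add: legendre_system_def degree_legendre_rec legendre_rec_orthogonal poly_legendre_rec_1)

lemma LBINT_poly_add:
  "(LBINT u:{-1..1}. poly (p + q) u * poly r u) =
    (LBINT u:{-1..1}. poly p u * poly r u) + (LBINT u:{-1..1}. poly q u * poly r u)"
  for p q r :: "real poly"
  using set_integral_add(2)[OF set_integrable_poly[of "-1" 1 "p * r"] set_integrable_poly[of "-1" 1 "q * r"]]
  by (simp add: distrib_right)

lemma LBINT_poly_smult:
  "(LBINT u:{-1..1}. poly (smult c p) u * poly r u) = c * (LBINT u:{-1..1}. poly p u * poly r u)"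
  for p r :: "real poly"
  by (simp add: mult.assoc)

text \<open>A continuous nonnegative integrand with integral 0 vanishes on the whole interval,
  giving infinitely many roots.\<close>

lemma LBINT_poly_square_zero:
  fixes p :: "real poly"
  assumes "(LBINT u:{-1..1}. poly p u * poly p u) = 0"
  shows "p = 0"
proof -
  have sq: "(\<lambda>u. poly p u * poly p u) = poly (p * p)" by auto
  have "integral {-1..1} (\<lambda>u. poly p u * poly p u) = 0"
    using assms set_borel_integral_eq_integral(2)[OF set_integrable_poly[of "-1" 1 "p * p"]]
    unfolding sq by simp
  then have "\<forall>u\<in>{-1..1}. poly p u * poly p u = 0"
    by (subst (asm) integral_eq_0_iff) (auto intro!: continuous_intros)
  then have "{-1..1} \<subseteq> {u. poly p u = 0}"
    by auto
  then have "infinite {u. poly p u = 0}"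
    using infinite_super[OF _ infinite_Icc[of "-1 :: real" 1]] by simp
  then show ?thesis
    using poly_roots_finite by auto
qed

text \<open>Induction on the degree, subtracting the multiple of \<open>L ?d\<close> that cancels
  the leading term. The alternative \<open>p = 0\<close> covers the zero polynomial, whose degree 0
  is not below \<open>n\<close> when \<open>n = 0\<close>.\<close>

lemma legendre_system_orthogonal_lower:
  assumes L: "legendre_system L" and "degree p < n \<or> p = 0"
  shows "(LBINT u:{-1..1}. poly p u * poly (L n) u) = 0"
  using assms(2)
proof (induction "degree p" arbitrary: p rule: less_induct)
  case less
  show ?case
  proof (cases "p = 0")
    case False
    let ?d = "degree p"
    define c where "c = lead_coeff p / lead_coeff (L ?d)"
    define q where "q = p - smult c (L ?d)"
    have deg: "degree (L ?d) = ?d" using L by (simp add: legendre_system_def)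
    have nz: "L ?d \<noteq> 0" using L by (auto simp: legendre_system_def dest!: spec[of _ ?d])
    then have lc: "coeff (L ?d) ?d \<noteq> 0" by (metis deg leading_coeff_0_iff)
    have "degree q \<le> ?d"
      unfolding q_def by (intro degree_diff_le) (auto simp: deg order_trans[OF degree_smult_le])
    moreover have "coeff q ?d = 0"
      using lc by (simp add: q_def c_def deg)
    ultimately have "degree q < ?d \<or> q = 0"
      by (rule eq_zero_or_degree_less[THEN disj_commute[THEN iffD1]])
    then have "(LBINT u:{-1..1}. poly q u * poly (L n) u) = 0"
      using less False by auto
    moreover have "(LBINT u:{-1..1}. poly (L ?d) u * poly (L n) u) = 0"
      using L less False by (auto simp: legendre_system_def)
    ultimately have "(LBINT u:{-1..1}. poly (q + smult c (L ?d)) u * poly (L n) u) = 0"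
      unfolding LBINT_poly_add LBINT_poly_smult by simp
    moreover have "q + smult c (L ?d) = p"
      by (simp add: q_def)
    ultimately show ?thesis by simp
  qed simp
qed

text \<open>Cancelling leading terms of \<open>L n\<close> and \<open>M n\<close> leaves
  \<open>q\<close>, which is orthogonal to both and hence to itself, so \<open>q = 0\<close>. The
  normalization at 1 then forces the ratio \<open>c\<close> to be 1.\<close>

lemma legendre_system_unique:
  assumes L: "legendre_system L" and M: "legendre_system M"
  shows "L = M"
proof
  fix n
  have deg: "degree (L n) = n" "degree (M n) = n"
    and one: "poly (L n) 1 = 1" "poly (M n) 1 = 1"
    using L M by (simp_all add: legendre_system_def)
  have "M n \<noteq> 0" using one by auto
  then have lc: "coeff (M n) n \<noteq> 0" by (metis deg(2) leading_coeff_0_iff)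
  define c where "c = lead_coeff (L n) / lead_coeff (M n)"
  define q where "q = L n + smult (- c) (M n)"
  have "degree q \<le> n"
    unfolding q_def by (intro degree_add_le) (auto simp: deg order_trans[OF degree_smult_le])
  moreover have "coeff q n = 0"
    using lc by (simp add: q_def c_def deg)
  ultimately have "degree q < n \<or> q = 0"
    by (rule eq_zero_or_degree_less[THEN disj_commute[THEN iffD1]])
  then have "(LBINT u:{-1..1}. poly q u * poly (L n) u) = 0" "(LBINT u:{-1..1}. poly q u * poly (M n) u) = 0"
    using legendre_system_orthogonal_lower L M by blast+
  then have "(LBINT u:{-1..1}. poly (L n + smult (- c) (M n)) u * poly q u) = 0"
    unfolding LBINT_poly_add LBINT_poly_smult by (simp add: mult.commute)
  then have "(LBINT u:{-1..1}. poly q u * poly q u) = 0"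
    unfolding q_def[symmetric] .
  then have q: "q = 0" by (rule LBINT_poly_square_zero)
  then have "poly q 1 = 0" by simp
  then have "c = 1" by (simp add: q_def one)
  then show "L n = M n" using q by (simp add: q_def)
qed

subsection \<open>Gauss's integral for the digamma function\<close>

lemma nn_integral_Ioi_eq_Ici:
  "(\<integral>\<^sup>+t. f t * indicator {a<..} t \<partial>lborel) = (\<integral>\<^sup>+t. f t * indicator {a..} t \<partial>lborel)"
  for f :: "real \<Rightarrow> ennreal"
  by (intro nn_integral_cong_AE eventually_mono[OF AE_lborel_singleton[of a]]) (auto simp: indicator_def)

lemma nn_integral_exp_Ioi:
  fixes u :: real
  assumes "u > 0"
  shows "(\<integral>\<^sup>+t. ennreal (exp (- u * t)) * indicator {0<..} t \<partial>lborel) = ennreal (1 / u)"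
proof -
  have "((\<lambda>t. - exp (- u * t) / u) \<longlongrightarrow> 0) at_top"
    using assms by real_asymp
  then have "(\<integral>\<^sup>+t. ennreal (exp (- u * t)) * indicator {0..} t \<partial>lborel) = ennreal (0 - (- exp (- u * 0) / u))"
    using assms by (intro nn_integral_FTC_atLeast) (auto intro!: derivative_eq_intros)
  then show ?thesis by (simp add: nn_integral_Ioi_eq_Ici)
qed

lemma has_bochner_integral_exp_Ioi:
  fixes u :: real
  assumes "u > 0"
  shows "has_bochner_integral lborel (\<lambda>t. indicator {0<..} t *\<^sub>R exp (- u * t)) (1 / u)"
proof (rule has_bochner_integral_nn_integral)
  show "(\<integral>\<^sup>+t. ennreal (indicator {0<..} t *\<^sub>R exp (- u * t)) \<partial>lborel) = ennreal (1 / u)"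
    unfolding nn_integral_exp_Ioi[OF assms, symmetric]
    by (intro nn_integral_cong) (auto simp: indicator_def)
qed (use assms in auto)

text \<open>The integrand is the integral of exp (- u t) over u from a to b; Tonelli swaps the
  integrals and leaves the integral of 1 / u.\<close>

lemma frullani_exp_nn_integral:
  fixes a b :: real
  assumes "0 < a" "a \<le> b"
  shows "(\<integral>\<^sup>+t. ennreal ((exp (- a * t) - exp (- b * t)) / t) * indicator {0<..} t \<partial>lborel) = ennreal (ln b - ln a)"
proof -
  have "(\<integral>\<^sup>+t. ennreal ((exp (- a * t) - exp (- b * t)) / t) * indicator {0<..} t \<partial>lborel) =
      (\<integral>\<^sup>+t. \<integral>\<^sup>+u. ennreal (exp (- u * t)) * indicator {a..b} u * indicator {0<..} t \<partial>lborel \<partial>lborel)"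
  proof (intro nn_integral_cong)
    fix t :: real
    show "ennreal ((exp (- a * t) - exp (- b * t)) / t) * indicator {0<..} t =
        (\<integral>\<^sup>+u. ennreal (exp (- u * t)) * indicator {a..b} u * indicator {0<..} t \<partial>lborel)"
    proof (cases "t > 0")
      case True
      have "(\<integral>\<^sup>+u. ennreal (exp (- u * t)) * indicator {a..b} u \<partial>lborel) =
          ennreal (- exp (- b * t) / t - (- exp (- a * t) / t))"
        using True assms by (intro nn_integral_FTC_Icc) (auto intro!: derivative_eq_intros)
      then show ?thesis using True by (simp add: diff_divide_distrib)
    qed simp
  qed
  also have "\<dots> = (\<integral>\<^sup>+u. \<integral>\<^sup>+t. ennreal (exp (- u * t)) * indicator {a..b} u * indicator {0<..} t \<partial>lborel \<partial>lborel)"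
    by (subst lborel_pair.Fubini') auto
  also have "\<dots> = (\<integral>\<^sup>+u. ennreal (1 / u) * indicator {a..b} u \<partial>lborel)"
  proof (intro nn_integral_cong)
    fix u :: real
    show "(\<integral>\<^sup>+t. ennreal (exp (- u * t)) * indicator {a..b} u * indicator {0<..} t \<partial>lborel) =
        ennreal (1 / u) * indicator {a..b} u"
      using nn_integral_exp_Ioi[of u] assms by (cases "u \<in> {a..b}") auto
  qed
  also have "\<dots> = ennreal (ln b - ln a)"
    using assms by (intro nn_integral_FTC_Icc) (auto intro!: derivative_eq_intros)
  finally show ?thesis .
qed

lemma frullani_exp:
  fixes a b :: real
  assumes "0 < a" "0 < b"
  shows "has_bochner_integral lborel
    (\<lambda>t. indicator {0<..} t *\<^sub>R ((exp (- a * t) - exp (- b * t)) / t)) (ln b - ln a)"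
proof -
  have *: "has_bochner_integral lborel
      (\<lambda>t. indicator {0<..} t *\<^sub>R ((exp (- a * t) - exp (- b * t)) / t)) (ln b - ln a)"
    if "0 < a" "a \<le> b" for a b :: real
  proof (rule has_bochner_integral_nn_integral)
    show "(\<integral>\<^sup>+t. ennreal (indicator {0<..} t *\<^sub>R ((exp (- a * t) - exp (- b * t)) / t)) \<partial>lborel) = ennreal (ln b - ln a)"
      unfolding frullani_exp_nn_integral[OF that, symmetric]
      by (intro nn_integral_cong) (auto simp: indicator_def)
  qed (use that in \<open>auto simp: indicator_def\<close>)
  show ?thesis
  proof (cases "a \<le> b")
    case False
    have "(\<lambda>t. indicator {0<..} t *\<^sub>R ((exp (- a * t) - exp (- b * t)) / t)) =
        (\<lambda>t. - (indicator {0<..} t *\<^sub>R ((exp (- b * t) - exp (- a * t)) / t)))"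
      by (auto simp: diff_divide_distrib algebra_simps)
    then show ?thesis
      using has_bochner_integral_minus[OF *[of b a]] assms False by simp
  qed (use * assms in auto)
qed

text \<open>Both sides follow from exp x \<ge> 1 + x, taken at x = - t and at x = t.\<close>

lemma bernoulli_kernel_bound:
  fixes t :: real
  assumes "t > 0"
  shows "\<bar>1 / t - 1 / (1 - exp (- t))\<bar> \<le> 1"
proof -
  have pos: "1 - exp (- t) > 0" using assms by simp
  have "1 - exp (- t) \<le> t" using exp_ge_add_one_self[of "- t"] by simp
  then have "1 / t \<le> 1 / (1 - exp (- t))" using pos by (intro divide_left_mono) auto
  moreover have "exp (- t) * (1 + t) \<le> 1"
    using exp_ge_add_one_self[of t] by (simp add: exp_minus field_simps)
  then have "1 / (1 - exp (- t)) \<le> 1 / t + 1"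
    using pos assms by (simp add: field_simps)
  ultimately show ?thesis by simp
qed

definition gauss_digamma_integrand :: "real \<Rightarrow> real \<Rightarrow> real" where
  "gauss_digamma_integrand z t = exp (- t) / t - exp (- z * t) / (1 - exp (- t))"

text \<open>Adding and subtracting exp (- z t) / t leaves a Frullani integral with value ln z and
  exp (- z t) times a kernel bounded by 1, which contributes at most 1 / z.\<close>

lemma gauss_digamma_integral_bound:
  assumes "z > 0"
  shows "set_integrable lborel {0<..} (gauss_digamma_integrand z)"
    and "\<bar>(LBINT t:{0<..}. gauss_digamma_integrand z t) - ln z\<bar> \<le> 1 / z"
proof -
  let ?g = "\<lambda>t::real. indicator {0<..} t *\<^sub>R (exp (- z * t) * (1 / t - 1 / (1 - exp (- t))))"
  let ?e = "\<lambda>t::real. indicator {0<..} t *\<^sub>R exp (- z * t)"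
  have e: "integrable lborel ?e" "integral\<^sup>L lborel ?e = 1 / z"
    using has_bochner_integral_exp_Ioi[OF assms] by (auto simp: has_bochner_integral_iff)
  have bound: "norm (?g t) \<le> ?e t" for t
    using bernoulli_kernel_bound[of t] by (auto simp: indicator_def abs_mult mult_left_le)
  have g: "integrable lborel ?g"
    by (rule Bochner_Integration.integrable_bound[OF e(1)]) (use bound in \<open>auto simp: indicator_def\<close>)
  have f: "has_bochner_integral lborel
      (\<lambda>t. indicator {0<..} t *\<^sub>R ((exp (- 1 * t) - exp (- z * t)) / t)) (ln z - ln 1)"
    by (rule frullani_exp) (use assms in auto)
  have split: "(\<lambda>t. indicator {0<..} t *\<^sub>R gauss_digamma_integrand z t) =
      (\<lambda>t. indicator {0<..} t *\<^sub>R ((exp (- 1 * t) - exp (- z * t)) / t) + ?g t)"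
    by (auto simp: gauss_digamma_integrand_def indicator_def field_simps diff_divide_distrib)
  have "has_bochner_integral lborel (\<lambda>t. indicator {0<..} t *\<^sub>R gauss_digamma_integrand z t)
      (ln z - ln 1 + integral\<^sup>L lborel ?g)"
    unfolding split by (intro has_bochner_integral_add f has_bochner_integral_integrable g)
  then show "set_integrable lborel {0<..} (gauss_digamma_integrand z)"
    and "\<bar>(LBINT t:{0<..}. gauss_digamma_integrand z t) - ln z\<bar> \<le> 1 / z"
    using Bochner_Integration.integral_norm_bound_integral[OF g e(1) bound] e(2)
    by (auto simp: has_bochner_integral_iff set_integrable_def set_lebesgue_integral_def)
qed

lemma gauss_digamma_integral_plus1:
  assumes "z > 0"
  shows "(LBINT t:{0<..}. gauss_digamma_integrand (z + 1) t) =
    (LBINT t:{0<..}. gauss_digamma_integrand z t) + 1 / z"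
proof -
  have e: "set_integrable lborel {0<..} (\<lambda>t. exp (- z * t))" "(LBINT t:{0<..}. exp (- z * t)) = 1 / z"
    using has_bochner_integral_exp_Ioi[OF assms]
    by (auto simp: has_bochner_integral_iff set_integrable_def set_lebesgue_integral_def)
  have "gauss_digamma_integrand (z + 1) t = gauss_digamma_integrand z t + exp (- z * t)" if "t > 0" for t
  proof -
    have "1 - exp (- t) \<noteq> 0" using that by simp
    moreover have "exp (- (z + 1) * t) = exp (- z * t) * exp (- t)"
      by (simp add: exp_add[symmetric] algebra_simps)
    ultimately show ?thesis
      by (simp add: gauss_digamma_integrand_def field_simps)
  qed
  then have "(LBINT t:{0<..}. gauss_digamma_integrand (z + 1) t) =
      (LBINT t:{0<..}. gauss_digamma_integrand z t + exp (- z * t))"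
    by (intro set_lebesgue_integral_cong) auto
  then show ?thesis
    using set_integral_add(2)[OF gauss_digamma_integral_bound(1)[OF assms] e(1)] e(2) by simp
qed

text \<open>The integral satisfies the digamma recurrence and is asymptotic to ln with error tending
  to 0; these two facts yield the limit formula for \<open>Digamma\<close>.\<close>

lemma gauss_digamma_integral:
  assumes "z > 0"
  shows "(LBINT t:{0<..}. gauss_digamma_integrand z t) = Digamma z"
proof -
  let ?F = "\<lambda>z. LBINT t:{0<..}. gauss_digamma_integrand z t"
  have shift: "?F (z + real m) = ?F z + (\<Sum>n<m. inverse (z + real n))" for m
  proof (induction m)
    case (Suc m)
    have "?F (z + real m + 1) = ?F (z + real m) + 1 / (z + real m)"
      using assms by (intro gauss_digamma_integral_plus1) simp
    then show ?case using Suc by (simp add: inverse_eq_divide add_ac)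
  qed simp
  have "(\<lambda>m. ?F (z + real m) - ln (z + real m)) \<longlonglongrightarrow> 0"
  proof (rule Lim_null_comparison)
    show "\<forall>\<^sub>F m in sequentially. norm (?F (z + real m) - ln (z + real m)) \<le> 1 / (z + real m)"
      using gauss_digamma_integral_bound(2)[of "z + real m" for m] assms by (intro always_eventually) simp
    show "(\<lambda>m. 1 / (z + real m)) \<longlonglongrightarrow> 0" by real_asymp
  qed
  \<comment> \<open>The limit formula for \<open>Digamma\<close> has \<open>ln m\<close> in place of
    \<open>ln (z + m)\<close>.\<close>
  moreover have "(\<lambda>m. ln (z + real m) - ln (real m)) \<longlonglongrightarrow> 0" by real_asymp
  ultimately have "(\<lambda>m. (?F (z + real m) - ln (z + real m)) + (ln (z + real m) - ln (real m))) \<longlonglongrightarrow> 0 + 0"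
    by (rule tendsto_add)
  then have "(\<lambda>m. ?F z - (ln (real m) - (\<Sum>n<m. inverse (z + real n)))) \<longlonglongrightarrow> 0"
    by (simp add: shift algebra_simps)
  moreover have "(\<lambda>m. ?F z - (ln (real m) - (\<Sum>n<m. inverse (z + real n)))) \<longlonglongrightarrow> ?F z - Digamma z"
    using Digamma_LIMSEQ[of z] assms by (intro tendsto_diff tendsto_const) auto
  ultimately show ?thesis using LIMSEQ_unique by fastforce
qed

subsection \<open>Fourier coefficients of Legendre polynomials\<close>

text \<open>The binomial series of (1 - a X)^(-1/2).\<close>

definition half_binom_fps :: "complex \<Rightarrow> complex fps" where
  "half_binom_fps a = Abs_fps (\<lambda>k. of_real (half_binom k) * a ^ k)"

text \<open>The differential equation of (1 - a X)^(-1/2); coefficientwise it is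
  \<open>half_binom_Suc\<close>.\<close>

lemma half_binom_fps_deriv:
  "(1 - fps_const a * fps_X) * fps_deriv (half_binom_fps a) = fps_const (a / 2) * half_binom_fps a"
proof (rule fps_ext)
  fix n
  have *: "half_binom (Suc n) * (1 + real n) = half_binom n * (1 / 2 + real n)" for n
    by (simp add: half_binom_Suc)
  have **: "of_real (half_binom (Suc n)) * (1 + of_nat n) =
      (of_real (half_binom n) * (1 / 2 + of_nat n) :: complex)" for n
    using arg_cong[OF *[of n], of complex_of_real] by simp
  have expand: "(1 - fps_const a * fps_X) * fps_deriv (half_binom_fps a) =
      fps_deriv (half_binom_fps a) - fps_const a * (fps_X * fps_deriv (half_binom_fps a))"
    by (simp add: algebra_simps)
  show "fps_nth ((1 - fps_const a * fps_X) * fps_deriv (half_binom_fps a)) n =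
      fps_nth (fps_const (a / 2) * half_binom_fps a) n"
  proof (cases n)
    case 0
    then show ?thesis using **[of 0] unfolding expand by (simp add: half_binom_fps_def)
  next
    case (Suc m)
    have "of_real (half_binom (Suc n)) * (1 + of_nat n) * a ^ Suc n =
        of_real (half_binom n) * (1 / 2 + of_nat n) * a ^ Suc n"
      unfolding ** by simp
    then show ?thesis using Suc unfolding expand by (simp add: half_binom_fps_def algebra_simps)
  qed
qed

text \<open>With \<open>a\<close> and \<open>b\<close> the exponentials of i \<theta> and - i
  \<theta> this is the trigonometric polynomial with Legendre weights.\<close>

definition legendre_trig :: "nat \<Rightarrow> complex \<Rightarrow> complex \<Rightarrow> complex" where
  "legendre_trig n a b = (\<Sum>k\<le>n. of_real (legendre_weight n k) * a ^ k * b ^ (n - k))"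

lemma legendre_trig_eq_fps: "legendre_trig n a b = fps_nth (half_binom_fps a * half_binom_fps b) n"
  unfolding legendre_trig_def fps_mult_nth half_binom_fps_def atMost_atLeast0
  by (intro sum.cong) (auto simp: legendre_weight_def)

text \<open>
  The generating function \<open>G = ((1 - a X) (1 - b X))\<^bsup>-1/2\<^esup>\<close> of the sums satisfies
  \<open>(1 - 2 u X + X\<^sup>2) G' = (u - X) G\<close>.
\<close>
lemma legendre_trig_rec:
  assumes "a * b = 1" "a + b = 2 * u"
  shows "(of_nat n + 2) * legendre_trig (Suc (Suc n)) a b =
    (2 * of_nat n + 3) * u * legendre_trig (Suc n) a b - (of_nat n + 1) * legendre_trig n a b"
proof -
  let ?A = "half_binom_fps a" and ?B = "half_binom_fps b"
  let ?G = "?A * ?B"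
  let ?p = "1 - fps_const a * fps_X" and ?q = "1 - fps_const b * fps_X"
  have ab: "fps_const a * fps_const b = 1" "fps_const a + fps_const b = 2 * fps_const u"
    using assms by (simp_all add: fps_numeral_fps_const)
  have half: "fps_const (c / 2) = fps_const (1 / 2) * fps_const c" for c :: complex
    by simp
  have two: "2 * fps_const (1 / 2 :: complex) = 1"
    by (simp add: fps_numeral_fps_const)
  have "?p * ?q * fps_deriv ?G = ?q * ?B * (?p * fps_deriv ?A) + ?p * ?A * (?q * fps_deriv ?B)"
    unfolding fps_deriv_mult by algebra
  also have "\<dots> = (fps_const (a / 2) * ?q + fps_const (b / 2) * ?p) * ?G"
    unfolding half_binom_fps_deriv by (simp only: distrib_left distrib_right mult_ac)
  also have "fps_const (a / 2) * ?q + fps_const (b / 2) * ?p = fps_const u - fps_X"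
    using ab two half[of a] half[of b] by algebra
  finally have ode: "?p * ?q * fps_deriv ?G = (fps_const u - fps_X) * ?G" .
  have "?p * ?q = 1 - 2 * fps_const u * fps_X + fps_X * fps_X"
    using ab by algebra
  moreover have "fps_const (2 * u) = 2 * fps_const u"
    by (simp add: fps_numeral_fps_const)
  ultimately have "fps_deriv ?G - fps_const (2 * u) * (fps_X * fps_deriv ?G) + fps_X * (fps_X * fps_deriv ?G)
      = fps_const u * ?G - fps_X * ?G"
    using ode by algebra
  \<comment> \<open>The coefficient of X^(n+1) links the sums of index n, n + 1 and n + 2, as in
    Bonnet's recurrence.\<close>
  then have "fps_nth (fps_deriv ?G - fps_const (2 * u) * (fps_X * fps_deriv ?G)
      + fps_X * (fps_X * fps_deriv ?G)) (Suc n) = fps_nth (fps_const u * ?G - fps_X * ?G) (Suc n)"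
    by simp
  then show ?thesis
    unfolding legendre_trig_eq_fps
    by (cases n) (simp_all add: algebra_simps del: fps_deriv_mult)
qed

lemma legendre_trig_eq_legendre_rec:
  assumes "a * b = 1" "a + b = 2 * of_real u"
  shows "legendre_trig n a b = of_real (poly (legendre_rec n) u)"
proof (induction n rule: legendre_rec.induct)
  case 1
  then show ?case by (simp add: legendre_trig_def legendre_weight_def)
next
  case 2
  have "legendre_trig (Suc 0) a b = (a + b) / 2"
    by (simp add: legendre_trig_def legendre_weight_def half_binom_Suc add_divide_distrib)
  then show ?case using assms(2) by simp
next
  case (3 n)
  have nz: "(of_nat n + 2 :: complex) \<noteq> 0"
    using of_nat_neq_0[of "Suc n", where 'a = complex] by (simp add: add.commute)
  have "(of_nat n + 2) * legendre_trig (Suc (Suc n)) a b =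
      of_real ((2 * real n + 3) * u * poly (legendre_rec (Suc n)) u - (real n + 1) * poly (legendre_rec n) u)"
    unfolding legendre_trig_rec[OF assms] using 3 by simp
  also have "\<dots> = (of_nat n + 2) * of_real (poly (legendre_rec (Suc (Suc n))) u)"
    unfolding poly_legendre_rec_Suc_Suc[symmetric] by simp
  finally show ?case
    using nz unfolding mult_cancel_left by blast
qed

section \<open>Identification of the polynomials given by definite descriptions\<close>

lemma legendre_poly_eq_legendre_rec: "legendre_poly = legendre_rec"
  unfolding legendre_poly_def legendre_system_def[symmetric]
  by (rule the_equality, rule legendre_system_legendre_rec,
      rule legendre_system_unique[OF _ legendre_system_legendre_rec])

text \<open>cos (pi x) takes every value in [-1, 1], so two representing polynomials agree on an
  infinite set.\<close>

lemma P_H_poly_eqI: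
  assumes "\<And>x. P_H H n x = of_real (poly p (cos (pi * x)))"
  shows "P_H_poly H n = p"
  unfolding P_H_poly_def
proof (rule the_equality)
  fix q assume q: "\<forall>x. P_H H n x = of_real (poly q (cos (pi * x)))"
  have "poly q u = poly p u" if "u \<in> {-1..1}" for u
  proof -
    have "cos (pi * (arccos u / pi)) = u" using that by simp
    then show ?thesis using q assms by (metis of_real_eq_iff)
  qed
  then have "{-1..1} \<subseteq> {u. poly (q - p) u = 0}" by auto
  then have "infinite {u. poly (q - p) u = 0}"
    using infinite_super[OF _ infinite_Icc[of "-1 :: real" 1]] by simp
  then show "q = p" using poly_roots_finite[of "q - p"] by auto
qed (use assms in simp)

lemma P_H_poly_legendre:
  assumes "v_H H n = legendre_weight n"
  shows "P_H_poly H n = legendre_rec n"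
proof (rule P_H_poly_eqI)
  fix x :: real
  let ?a = "exp (\<i> * of_real (pi * x))" and ?b = "exp (- \<i> * of_real (pi * x))"
  \<comment> \<open>Since ?a ?b = 1, the term ?b^n ?a^(2k) equals ?a^k ?b^(n-k).\<close>
  have "exp (- \<i> * of_real (pi * real n * x)) * exp (2 * \<i> * of_real (pi * real k * x)) =
      ?a ^ k * ?b ^ (n - k)" if "k \<le> n" for k
    using that by (simp add: exp_add[symmetric] exp_of_nat_mult[symmetric] of_nat_diff algebra_simps)
  then have "P_H H n x = legendre_trig n ?a ?b"
    unfolding P_H_def legendre_trig_def assms sum_distrib_left by (intro sum.cong) (auto simp: mult_ac)
  also have "\<dots> = of_real (poly (legendre_rec n) (cos (pi * x)))"
  proof (rule legendre_trig_eq_legendre_rec)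
    show "?a * ?b = 1" by (simp add: exp_add[symmetric])
    show "?a + ?b = 2 * of_real (cos (pi * x))"
      by (simp add: cos_of_real[symmetric] cos_exp_eq)
  qed
  finally show "P_H H n x = of_real (poly (legendre_rec n) (cos (pi * x)))" .
qed

subsection \<open>The quadratic form\<close>

text \<open>Here \<open>H 0 = 1\<close>, and the factor exp (- t / 2) shifts \<open>s\<close> by 1/2
  in Gauss's integrand.\<close>

lemma psi_H_eq_Digamma:
  fixes s :: real
  assumes "\<And>t. t \<ge> 0 \<Longrightarrow> H t = exp (- t / 2)" "s \<ge> 0"
  shows "psi_H H s = Digamma (s + 1 / 2)"
proof -
  have "psi_H H s = (LBINT t:{0<..}. gauss_digamma_integrand (s + 1 / 2) t)"
    unfolding psi_H_def
    by (intro set_lebesgue_integral_cong)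
       (auto simp: assms(1) gauss_digamma_integrand_def exp_add[symmetric] algebra_simps)
  then show ?thesis using assms(2) by (simp add: gauss_digamma_integral)
qed

lemma Digamma_half_shift:
  "Digamma (real m + 1 / 2) = Digamma (1 / 2) + (\<Sum>l<m. 1 / (1 / 2 + real l))"
proof (induction m)
  case (Suc m)
  have "Digamma (real m + 1 / 2 + 1) = Digamma (real m + 1 / 2) + 1 / (real m + 1 / 2)"
    by (intro Digamma_plus1) (simp add: add_nonneg_eq_0_iff)
  then show ?case using Suc by (simp add: add_ac)
qed simp

text \<open>Moving from row i to i + 1 increases the distance to j by one if j \<le> i and decreases
  it by one otherwise; the sign of i + 1/2 - j accounts for both cases.\<close>

lemma Digamma_half_difference:
  "Digamma (\<bar>real (Suc i) - real j\<bar> + 1 / 2) - Digamma (\<bar>real i - real j\<bar> + 1 / 2) =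
    1 / (real i + 1 / 2 - real j)"
proof (cases "j \<le> i")
  case True
  then have *: "\<bar>real (Suc i) - real j\<bar> = real (Suc (i - j))" "\<bar>real i - real j\<bar> = real (i - j)"
    by (simp_all add: of_nat_diff)
  show ?thesis using True
    unfolding * Digamma_half_shift by (simp add: of_nat_diff algebra_simps)
next
  case False
  define m where "m = j - Suc i"
  have j: "j = Suc (i + m)" using False by (simp add: m_def)
  have *: "\<bar>real (Suc i) - real j\<bar> = real m" "\<bar>real i - real j\<bar> = real (Suc m)"
    by (simp_all add: j)
  have "1 / (real i + 1 / 2 - real j) = - (1 / (1 / 2 + real m))"
    unfolding minus_divide_right by (simp add: j)
  then show ?thesis unfolding * Digamma_half_shift by simp
qed

definition psi_row :: "nat \<Rightarrow> (nat \<Rightarrow> real) \<Rightarrow> nat \<Rightarrow> real" where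
  "psi_row n v i = (\<Sum>j\<le>n. v j * Digamma (\<bar>real i - real j\<bar> + 1 / 2))"

lemma psi_row_Suc:
  "psi_row n v (Suc i) - psi_row n v i = (\<Sum>j\<le>n. v j / (real i + 1 / 2 - real j))"
  unfolding psi_row_def sum_subtractf[symmetric] right_diff_distrib[symmetric] Digamma_half_difference
  by simp

text \<open>The harmonic sum evaluates row 0, and the Cauchy equations make consecutive rows
  equal.\<close>

lemma psi_row_legendre_weight:
  assumes "i \<le> n"
  shows "psi_row n (legendre_weight n) i = Digamma (1 / 2) + harm n"
  using assms
proof (induction i)
  case 0
  have "psi_row n (legendre_weight n) 0 = (\<Sum>j\<le>n. legendre_weight n j * Digamma (1 / 2) +
      legendre_weight n j * (\<Sum>l<j. 1 / (1 / 2 + real l)))"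
    unfolding psi_row_def by (simp add: Digamma_half_shift distrib_left)
  then show ?case
    by (simp only: sum.distrib sum_legendre_weight_odd_harm sum_distrib_right[symmetric]
        sum_legendre_weight mult_1)
next
  case (Suc i)
  then show ?case
    using psi_row_Suc[of n "legendre_weight n" i] legendre_weight_cauchy[of i n] by simp
qed

context
  fixes H :: "real \<Rightarrow> real"
  assumes H: "\<And>t. t \<ge> 0 \<Longrightarrow> H t = exp (- t / 2)"
begin

lemma b_H_eq_psi_row: "b_H H n v x = (\<Sum>i\<le>n. x i * psi_row n v i)"
  unfolding b_H_def psi_row_def sum_distrib_left
  by (subst sum.swap) (simp add: psi_H_eq_Digamma H abs_minus_commute mult_ac)

text \<open>Constant rows turn the pairing into a multiple of \<open>phi_sum\<close>; this gives
  both orthogonality to its kernel and the value of the form.\<close>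

lemma b_H_legendre_weight:
  "b_H H n (legendre_weight n) x = (Digamma (1 / 2) + harm n) * phi_sum n x"
  unfolding b_H_eq_psi_row phi_sum_def sum_distrib_left
  by (intro sum.cong) (auto simp: psi_row_legendre_weight)

lemma orthogonal_cauchy:
  assumes orth: "\<forall>x\<in>coord_space n. phi_sum n x = 0 \<longrightarrow> b_H H n v x = 0" and "i < n"
  shows "(\<Sum>j\<le>n. v j / (real i + 1 / 2 - real j)) = 0"
proof -
  \<comment> \<open>The difference of neighbouring unit vectors lies in the kernel of
    \<open>phi_sum\<close> and picks out the difference of consecutive rows.\<close>
  define x :: "nat \<Rightarrow> real" where "x k = of_bool (k = Suc i) - of_bool (k = i)" for k
  have sum_x: "(\<Sum>k\<le>n. x k * f k) = f (Suc i) - f i" for f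
  proof -
    have "(\<Sum>k\<le>n. x k * f k) = (\<Sum>k\<le>n. if k = Suc i then f k else 0) - (\<Sum>k\<le>n. if k = i then f k else 0)"
      unfolding sum_subtractf[symmetric] by (intro sum.cong) (auto simp: x_def)
    then show ?thesis using \<open>i < n\<close> by simp
  qed
  have "x \<in> coord_space n" using \<open>i < n\<close> by (auto simp: coord_space_def x_def)
  moreover have "phi_sum n x = 0" using sum_x[of "\<lambda>_. 1"] by (simp add: phi_sum_def)
  ultimately have "b_H H n v x = 0" using orth by blast
  then show ?thesis unfolding b_H_eq_psi_row sum_x psi_row_Suc .
qed

text \<open>For uniqueness, the difference of a candidate and the weights has sum 0 and solves the
  homogeneous Cauchy equations.\<close>

lemma v_H_eq_legendre_weight: "v_H H n = legendre_weight n"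
  unfolding v_H_def
proof (rule the_equality)
  fix v assume v: "v \<in> coord_space n \<and>
      (\<forall>x\<in>coord_space n. phi_sum n x = 0 \<longrightarrow> b_H H n v x = 0) \<and> phi_sum n v = 1"
  have "v j - legendre_weight n j = 0" if "j \<le> n" for j
  proof (rule cauchy_kernel_trivial[OF _ _ that])
    show "(\<Sum>j\<le>n. v j - legendre_weight n j) = 0"
      using v by (simp add: sum_subtractf sum_legendre_weight phi_sum_def)
    show "(\<Sum>j\<le>n. (v j - legendre_weight n j) / (real i + 1 / 2 - real j)) = 0" if "i < n" for i
      using orthogonal_cauchy[of n v i] v legendre_weight_cauchy[OF that] that
      by (simp add: diff_divide_distrib sum_subtractf)
  qed
  moreover have "v j = legendre_weight n j" if "j > n" for j
    using v that by (simp add: coord_space_def legendre_weight_beyond)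
  ultimately show "v = legendre_weight n"
    by (metis eq_iff_diff_eq_0 ext not_le)
qed (simp_all add: coord_space_def legendre_weight_beyond b_H_legendre_weight phi_sum_def
    sum_legendre_weight)

lemma t_H_eq: "t_H H n = Digamma (1 / 2) + harm n"
proof -
  have "t_H H n = b_H H n (legendre_weight n) (legendre_weight n)"
    by (simp add: t_H_def q_H_def b_H_def v_H_eq_legendre_weight)
  then show ?thesis
    by (simp add: b_H_legendre_weight phi_sum_def sum_legendre_weight)
qed

end

theorem proposition2p12:
  fixes H :: "real \<Rightarrow> real" and n :: nat
  assumes "\<And>t. t \<ge> 0 \<Longrightarrow> H t = exp (- t / 2)"
  shows "P_H_poly H n = legendre_poly n \<and> t_H H n = Digamma (1 / 2) + harm n"
  using P_H_poly_legendre[OF v_H_eq_legendre_weight[OF assms]] t_H_eq[OF assms]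
  by (simp add: legendre_poly_eq_legendre_rec)

end
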